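(* Let $X$ be a complex Banach space, and let $A,B\in\mathcal{B}(X)^D$ be $\{A,B\}$-weakly commutative with $A^2A^D(I+A^DB)\in\mathcal{B}(X)^D$. Then $A+B\in\mathcal{B}(X)^D$, and $$(A+B)^D=\left(A^2A^D(I+A^DB)\right)^D+(I-AA^D)B^D\left(A(I-AA^D)B^D+I\right)^{-1}$$ $$=\left(A^2A^D(I+A^DB)\right)^D+(I-AA^D)B^D\left(\sum_{n=0}^{i(A)-1}(-AB)^{n}(B^D)^{2n}\right).$$
   Context: $\mathcal{B}(X)$ is the algebra of bounded linear operators on the complex Banach space $X$, $I$ the identity operator. $A\in\mathcal{B}(X)$ is Drazin invertible if there is $A^D\in\mathcal{B}(X)$ (the Drazin inverse of $A$, unique when it exists) with $AA^D=A^DA$, $A^DAA^D=A^D$ and $A(I-AA^D)$ nilpotent; the index $i(A)$ is the least non-negative integer $k$ with $(A(I-AA^D))^k=0$; $\mathcal{B}(X)^D$ is the set of Drazin invertible operators. Operators $A,B\in\mathcal{B}(X)$ are $A$-weakly commutative if there is $C_1\in\mathcal{B}(X)$ with $AB=C_1A$ and $BA=AC_1$; they are $B$-weakly commutative if there is $C_2\in\mathcal{B}(X)$ with $AB=BC_2$ and $BA=C_2B$; they are $\{A,B\}$-weakly commutative if they are both $A$-weakly commutative and $B$-weakly commutative. *)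

theory Defs
  imports Complex_Main
begin

section \<open>Complex Banach spaces\<close>

class complex_normed_vector = real_normed_vector +
  fixes scaleC :: "complex \<Rightarrow> 'a \<Rightarrow> 'a"  (infixr "*\<^sub>C" 75)
  assumes scaleC_add_right: "c *\<^sub>C (x + y) = c *\<^sub>C x + c *\<^sub>C y"
    and scaleC_add_left: "(c + d) *\<^sub>C x = c *\<^sub>C x + d *\<^sub>C x"
    and scaleC_scaleC: "c *\<^sub>C (d *\<^sub>C x) = (c * d) *\<^sub>C x"
    and scaleC_of_real: "complex_of_real r *\<^sub>C x = r *\<^sub>R x"
    and norm_scaleC: "norm (c *\<^sub>C x) = cmod c * norm x"

class complex_banach = complex_normed_vector + banach

instantiation complex :: complex_banach
begin

definition scaleC_complex :: "complex \<Rightarrow> complex \<Rightarrow> complex"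
  where "scaleC_complex = (*)"

instance
  by standard
    (simp_all add: scaleC_complex_def algebra_simps norm_mult scaleR_conv_of_real)

end


section \<open>The algebra of bounded operators\<close>

text \<open>
  Real boundedness and linearity is expressed by the library predicate
  \<^const>\<open>bounded_linear\<close>; compatibility with complex scalars is added to it.
\<close>

typedef (overloaded) 'a bounded_op =
  "{f :: 'a::complex_normed_vector \<Rightarrow> 'a. bounded_linear f \<and> (\<forall>c x. f (c *\<^sub>C x) = c *\<^sub>C f x)}"
  morphisms apply_op Bounded_op
proof
  show "(\<lambda>x. x) \<in> {f :: 'a \<Rightarrow> 'a. bounded_linear f \<and> (\<forall>c x. f (c *\<^sub>C x) = c *\<^sub>C f x)}"
    by (simp add: bounded_linear_ident)
qed

setup_lifting type_definition_bounded_op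

lemma scaleC_zero_right: "c *\<^sub>C (0 :: 'a::complex_normed_vector) = 0"
  using scaleC_add_right[of c 0 "0 :: 'a"] by simp

lemma scaleC_minus_right: "c *\<^sub>C (- x) = - (c *\<^sub>C (x :: 'a::complex_normed_vector))"
  using scaleC_add_right[of c x "- x"]
  by (simp add: scaleC_zero_right eq_neg_iff_add_eq_0 add.commute)

lemma scaleC_diff_right: "c *\<^sub>C (x - y) = c *\<^sub>C x - c *\<^sub>C (y :: 'a::complex_normed_vector)"
  using scaleC_add_right[of c x "- y"] by (simp add: scaleC_minus_right)

text \<open>
  The class \<^class>\<open>ring_1\<close> would require \<open>0 \<noteq> 1\<close> and so exclude the
  zero space; hence the separate classes \<^class>\<open>ring\<close> and \<^class>\<open>monoid_mult\<close>.
\<close>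

instantiation bounded_op :: (complex_normed_vector) "{ring, monoid_mult}"
begin

lift_definition zero_bounded_op :: "'a bounded_op" is "\<lambda>x. 0"
  by (simp add: scaleC_zero_right)

lift_definition one_bounded_op :: "'a bounded_op" is "\<lambda>x. x"
  by (simp add: bounded_linear_ident)

lift_definition plus_bounded_op :: "'a bounded_op \<Rightarrow> 'a bounded_op \<Rightarrow> 'a bounded_op"
  is "\<lambda>f g x. f x + g x"
  by (simp add: bounded_linear_add scaleC_add_right)

lift_definition minus_bounded_op :: "'a bounded_op \<Rightarrow> 'a bounded_op \<Rightarrow> 'a bounded_op"
  is "\<lambda>f g x. f x - g x"
  by (simp add: bounded_linear_sub scaleC_diff_right)

lift_definition uminus_bounded_op :: "'a bounded_op \<Rightarrow> 'a bounded_op"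
  is "\<lambda>f x. - f x"
  by (simp add: bounded_linear_minus scaleC_minus_right)

lift_definition times_bounded_op :: "'a bounded_op \<Rightarrow> 'a bounded_op \<Rightarrow> 'a bounded_op"
  is "\<lambda>f g x. f (g x)"
  by (simp add: bounded_linear_compose)

instance
proof
  fix a b c :: "'a bounded_op"
  show "(a + b) * c = a * c + b * c" by transfer simp
  show "a * (b + c) = a * b + a * c"
    by transfer (auto simp: fun_eq_iff linear_add dest!: bounded_linear.linear)
qed (transfer; simp add: algebra_simps)+

end


section \<open>Drazin inverses\<close>

definition nilpotent :: "'a::{ring, monoid_mult} \<Rightarrow> bool"
  where "nilpotent a \<longleftrightarrow> (\<exists>k. a ^ k = 0)"

definition is_drazin_inverse :: "'a::{ring, monoid_mult} \<Rightarrow> 'a \<Rightarrow> bool"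
  where "is_drazin_inverse a d \<longleftrightarrow>
    a * d = d * a \<and> d * a * d = d \<and> nilpotent (a * (1 - a * d))"

definition drazin_invertible :: "'a::{ring, monoid_mult} \<Rightarrow> bool"
  where "drazin_invertible a \<longleftrightarrow> (\<exists>d. is_drazin_inverse a d)"

definition drazin_inverse :: "'a::{ring, monoid_mult} \<Rightarrow> 'a"  ("_\<^sup>D" [1000] 999)
  where "a\<^sup>D = (THE d. is_drazin_inverse a d)"

text \<open>
  Since \<open>0 ^ 0 = 1\<close>, an invertible element of a nonzero ring has index 1, not 0, here.
\<close>

definition drazin_index :: "'a::{ring, monoid_mult} \<Rightarrow> nat"
  where "drazin_index a = (LEAST k. (a * (1 - a * a\<^sup>D)) ^ k = 0)"

definition is_two_sided_inverse :: "'a::monoid_mult \<Rightarrow> 'a \<Rightarrow> bool"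
  where "is_two_sided_inverse a b \<longleftrightarrow> a * b = 1 \<and> b * a = 1"

definition two_sided_invertible :: "'a::monoid_mult \<Rightarrow> bool"
  where "two_sided_invertible a \<longleftrightarrow> (\<exists>b. is_two_sided_inverse a b)"

definition two_sided_inverse :: "'a::monoid_mult \<Rightarrow> 'a"
  where "two_sided_inverse a = (THE b. is_two_sided_inverse a b)"


section \<open>Weak commutativity\<close>

definition left_weakly_commutative :: "'a::semigroup_mult \<Rightarrow> 'a \<Rightarrow> bool"
  where "left_weakly_commutative a b \<longleftrightarrow> (\<exists>c. a * b = c * a \<and> b * a = a * c)"

definition right_weakly_commutative :: "'a::semigroup_mult \<Rightarrow> 'a \<Rightarrow> bool"
  where "right_weakly_commutative a b \<longleftrightarrow> (\<exists>c. a * b = b * c \<and> b * a = c * b)"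

text \<open>
  Left, right and two-sided weak commutativity of \<open>a\<close> and \<open>b\<close> are what is called
  \<open>a\<close>-weak, \<open>b\<close>-weak and \<open>{a, b}\<close>-weak commutativity.
\<close>

definition weakly_commutative :: "'a::semigroup_mult \<Rightarrow> 'a \<Rightarrow> bool"
  where "weakly_commutative a b \<longleftrightarrow>
    left_weakly_commutative a b \<and> right_weakly_commutative a b"

end

theory Submission
  imports Defs
begin

text \<open>
  The argument is purely ring theoretic.  Weak commutativity gives
  \<open>a\<^sup>2 * b = a * c * a = b * a\<^sup>2\<close>, and symmetrically \<open>b\<^sup>2\<close> commutes with
  \<open>a\<close>.  A Drazin inverse lies in the double commutant
  (\<open>drazin_inverse_bicommutant\<close>), and the squares of \<open>a\<^sup>D\<close> and \<open>b\<^sup>D\<close> are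
  the Drazin inverses of \<open>a\<^sup>2\<close> and \<open>b\<^sup>2\<close>.  Hence the idempotents
  \<open>p = a * a\<^sup>D\<close> and \<open>b * b\<^sup>D\<close>, as well as these squares, commute with both \<open>a\<close>
  and \<open>b\<close>, although \<open>a\<^sup>D\<close> and \<open>b\<close> in general do not commute.

  With \<open>q = 1 - p\<close> the sum splits into orthogonal parts
  \<open>p * (a + b)\<close> and \<open>q * (a + b)\<close>, so a Drazin inverse of \<open>a + b\<close> is the sum of
  Drazin inverses of the parts (\<open>drazin_inverse_orthogonal_add\<close>).  The first part
  equals \<open>a\<^sup>2 * a\<^sup>D * (1 + a\<^sup>D * b)\<close>, whose Drazin invertibility is assumed.
  In the second part \<open>a * q\<close> is nilpotent of order \<open>k\<close>, the index of \<open>a\<close>.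
  Moving all factors \<open>a\<close> to the left by weak commutativity shows that
  \<open>(a * b)\<^sup>n\<close> is a right multiple of \<open>a\<^sup>n\<close>
  (\<open>left_weakly_commutative_power\<close>).  Therefore \<open>x = a * q * b\<^sup>D\<close> satisfies
  \<open>(- x)\<^sup>k = 0\<close>, and \<open>1 + x\<close> is inverted by a finite geometric series.  So
  \<open>q * (a + b)\<close> is a perturbation of \<open>q * b\<close> with Drazin inverse
  \<open>q * b\<^sup>D * (1 + x)\<^sup>-\<^sup>1\<close> (\<open>drazin_inverse_perturbation\<close>); the nilpotency that
  this needs is that of a sum of weakly commuting nilpotent elements
  (\<open>nilpotent_add_weakly_commutative\<close>).  Expanding the geometric series with
  \<open>b\<^sup>D = b * (b\<^sup>D)\<^sup>2\<close> yields the second formula.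
\<close>

section \<open>Commuting elements\<close>

definition commuting :: "'a::semigroup_mult \<Rightarrow> 'a \<Rightarrow> bool"
  where "commuting x y \<longleftrightarrow> x * y = y * x"

lemma commuting_sym: "commuting x y \<Longrightarrow> commuting y x"
  by (simp add: commuting_def)

lemma commuting_refl [simp]: "commuting x x"
  by (simp add: commuting_def)

lemma commuting_mult: "commuting x y \<Longrightarrow> commuting x z \<Longrightarrow> commuting x (y * z)"
  unfolding commuting_def by (metis mult.assoc)

lemma commuting_power:
  fixes x y :: "'a::monoid_mult"
  assumes "commuting x y"
  shows "commuting x (y ^ n)"
  using assms by (induction n) (simp_all add: commuting_def, metis mult.assoc)

lemma commuting_one [simp]: "commuting x (1 :: 'a::monoid_mult)"
  by (simp add: commuting_def)

lemma commuting_add: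
  fixes x y z :: "'a::ring"
  shows "commuting x y \<Longrightarrow> commuting x z \<Longrightarrow> commuting x (y + z)"
  by (simp add: commuting_def algebra_simps)

lemma commuting_diff:
  fixes x y z :: "'a::ring"
  shows "commuting x y \<Longrightarrow> commuting x z \<Longrightarrow> commuting x (y - z)"
  by (simp add: commuting_def algebra_simps)

lemma commuting_minus:
  fixes x y :: "'a::ring"
  shows "commuting x y \<Longrightarrow> commuting x (- y)"
  by (simp add: commuting_def)

lemma commuting_one_left [simp]: "commuting (1 :: 'a::monoid_mult) x"
  by (simp add: commuting_def)

lemma commuting_mult_left: "commuting y x \<Longrightarrow> commuting z x \<Longrightarrow> commuting (y * z) x"
  using commuting_mult commuting_sym by blast

lemma commuting_add_left:
  fixes x y z :: "'a::ring"
  shows "commuting y x \<Longrightarrow> commuting z x \<Longrightarrow> commuting (y + z) x"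
  using commuting_add commuting_sym by blast

lemma commuting_diff_left:
  fixes x y z :: "'a::ring"
  shows "commuting y x \<Longrightarrow> commuting z x \<Longrightarrow> commuting (y - z) x"
  using commuting_diff commuting_sym by blast

lemmas commuting_intros =
  commuting_refl commuting_one commuting_one_left
  commuting_mult commuting_add commuting_diff
  commuting_mult_left commuting_add_left commuting_diff_left

lemma power_mult_commuting:
  fixes x y :: "'a::monoid_mult"
  assumes "commuting x y"
  shows "(x * y) ^ n = x ^ n * y ^ n"
proof (induction n)
  case (Suc n)
  have "y * x ^ n = x ^ n * y"
    using commuting_power[OF commuting_sym[OF assms]] by (simp add: commuting_def)
  then show ?case
    using Suc by (simp add: mult.assoc) (metis mult.assoc)
qed simp

lemma idempotent_power:
  fixes q :: "'a::monoid_mult"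
  assumes "q * q = q"
  shows "q * q ^ n = q"
proof (induction n)
  case (Suc n)
  then show ?case
    using assms by (simp add: mult.assoc[symmetric])
qed simp

section \<open>Nilpotent elements\<close>

lemma power_zero_mono:
  fixes x :: "'a::{ring, monoid_mult}"
  assumes "x ^ k = 0" "k \<le> n"
  shows "x ^ n = 0"
  using assms by (metis le_add_diff_inverse mult_zero_left power_add)

lemma nilpotent_mult_commuting:
  fixes x y :: "'a::{ring, monoid_mult}"
  assumes "nilpotent x" "commuting x y"
  shows "nilpotent (x * y)"
  using assms power_mult_commuting[OF assms(2)] unfolding nilpotent_def
  by (metis mult_zero_left)

lemma nilpotent_swap:
  fixes x y :: "'a::{ring, monoid_mult}"
  assumes "nilpotent (x * y)"
  shows "nilpotent (y * x)"
proof -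
  from assms obtain k where k: "(x * y) ^ k = 0"
    by (auto simp: nilpotent_def)
  have "(y * x) ^ Suc n = y * (x * y) ^ n * x" for n
  proof (induction n)
    case (Suc n)
    have "(y * x) ^ Suc (Suc n) = y * x * (y * x) ^ Suc n" by simp
    also have "\<dots> = y * (x * y) ^ Suc n * x"
      unfolding Suc by (simp add: mult.assoc)
    finally show ?case .
  qed simp
  with k have "(y * x) ^ Suc k = 0" by simp
  then show ?thesis unfolding nilpotent_def by blast
qed

text \<open>
  This avoids the binomial formula: expanding one factor \<open>x + y\<close> at a time in
  \<open>x\<^sup>i * y\<^sup>j * (x + y)\<^sup>l\<close> keeps the total degree \<open>i + j + l\<close> fixed, and once
  \<open>l = 0\<close> a total degree of at least \<open>m + n\<close> forces \<open>m \<le> i\<close> or \<open>n \<le> j\<close>.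
\<close>
lemma nilpotent_add_commuting:
  fixes x y :: "'a::{ring, monoid_mult}"
  assumes "nilpotent x" "nilpotent y" "commuting x y"
  shows "nilpotent (x + y)"
proof -
  from assms obtain m n where mn: "x ^ m = 0" "y ^ n = 0"
    by (auto simp: nilpotent_def)
  have "x ^ i * y ^ j * (x + y) ^ l = 0" if "m + n \<le> i + j + l" for i j l
    using that
  proof (induction l arbitrary: i j)
    case 0
    then have "m \<le> i \<or> n \<le> j" by linarith
    then show ?case
      using power_zero_mono mn by fastforce
  next
    case (Suc l)
    have "y ^ j * x = x * y ^ j"
      using commuting_power[OF assms(3)] by (simp add: commuting_def)
    then have "x ^ i * y ^ j * x = x ^ Suc i * y ^ j"
      by (metis mult.assoc power_Suc2)
    moreover have "x ^ i * y ^ j * y = x ^ i * y ^ Suc j"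
      by (metis mult.assoc power_Suc2)
    moreover have "x ^ i * y ^ j * (x + y) ^ Suc l
        = (x ^ i * y ^ j * x + x ^ i * y ^ j * y) * (x + y) ^ l"
      by (simp only: power_Suc distrib_left distrib_right mult.assoc)
    ultimately have "x ^ i * y ^ j * (x + y) ^ Suc l
        = x ^ Suc i * y ^ j * (x + y) ^ l + x ^ i * y ^ Suc j * (x + y) ^ l"
      by (simp only: distrib_right)
    then show ?case
      using Suc.IH[of "Suc i" j] Suc.IH[of i "Suc j"] Suc.prems by simp
  qed
  from this[of 0 0 "m + n"] show ?thesis
    unfolding nilpotent_def by auto
qed

lemma neumann_series_nilpotent:
  fixes x :: "'a::{ring, monoid_mult}"
  assumes "(- x) ^ k = 0"
  shows "is_two_sided_inverse (x + 1) (\<Sum>n<k. (- x) ^ n)"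
proof -
  have "(x + 1) * (\<Sum>n<k. (- x) ^ n) = 1 - (- x) ^ k" for k
    by (induction k) (simp_all add: distrib_left distrib_right)
  moreover have "(\<Sum>n<k. (- x) ^ n) * (x + 1) = 1 - (- x) ^ k" for k
    by (induction k)
      (simp_all add: distrib_left distrib_right power_Suc2 del: power_Suc, simp add: algebra_simps)
  ultimately show ?thesis
    using assms by (simp add: is_two_sided_inverse_def)
qed

lemma two_sided_inverse_eqI:
  assumes "is_two_sided_inverse a b"
  shows "two_sided_inverse a = b"
  unfolding two_sided_inverse_def
proof (rule the_equality)
  fix c assume "is_two_sided_inverse a c"
  with assms show "c = b"
    unfolding is_two_sided_inverse_def by (metis mult.assoc mult_1_left mult_1_right)
qed (fact assms)

section \<open>Uniqueness and double commutant of the Drazin inverse\<close>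

lemma drazin_inverse_facts:
  fixes a d :: "'a::{ring, monoid_mult}"
  assumes "is_drazin_inverse a d"
  shows "a * d = d * a" "d * a * d = d" "d * (a * d) = d" "a * d * d = d"
    "a * d * (a * d) = a * d"
    "(1 - a * d) * (1 - a * d) = 1 - a * d"
    "commuting a d" "commuting a (a * d)" "commuting a (1 - a * d)"
    "nilpotent (a * (1 - a * d))"
proof -
  show c: "a * d = d * a" and i: "d * a * d = d"
    and "nilpotent (a * (1 - a * d))"
    using assms unfolding is_drazin_inverse_def by blast+
  show "d * (a * d) = d" "a * d * d = d"
    using c i by (simp_all add: mult.assoc)
  then show "a * d * (a * d) = a * d"
    by (simp add: mult.assoc)
  then show "(1 - a * d) * (1 - a * d) = 1 - a * d"
    by (simp add: left_diff_distrib right_diff_distrib)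
  show "commuting a d"
    using c by (simp add: commuting_def)
  then show "commuting a (a * d)" "commuting a (1 - a * d)"
    by (simp_all add: commuting_intros)
qed

text \<open>
  The idempotent \<open>a * d\<close> factors through high powers of \<open>a\<close>, and its complement is
  annihilated by them; this turns statements about \<open>d\<close> into statements about
  powers of \<open>a\<close>.
\<close>
lemma drazin_idempotent_power:
  fixes a d :: "'a::{ring, monoid_mult}"
  assumes "is_drazin_inverse a d"
  obtains k where "a ^ k * (1 - a * d) = 0" "a * d = a ^ k * d ^ k" "a * d = d ^ k * a ^ k"
proof -
  note f = drazin_inverse_facts[OF assms]
  from assms obtain m where m: "(a * (1 - a * d)) ^ m = 0"
    by (auto simp: is_drazin_inverse_def nilpotent_def)
  \<comment> \<open>The exponent must be positive: an idempotent equals its positive powers, but its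
    power with exponent \<open>0\<close> is \<open>1\<close>.\<close>
  let ?k = "Suc m"
  have "a ^ ?k * (1 - a * d) = a ^ ?k * (1 - a * d) ^ ?k"
    using idempotent_power[OF f(6)] by simp
  also have "\<dots> = (a * (1 - a * d)) ^ ?k"
    by (rule power_mult_commuting[OF f(9), symmetric])
  also have "\<dots> = 0"
    using m by simp
  finally have 1: "a ^ ?k * (1 - a * d) = 0" .
  have "a * d = (a * d) ^ ?k"
    using idempotent_power[OF f(5)] by simp
  then have "a * d = a ^ ?k * d ^ ?k" "a * d = d ^ ?k * a ^ ?k"
    using power_mult_commuting[of a d ?k] power_mult_commuting[of d a ?k] f(1)
    by (simp_all add: commuting_def)
  with 1 show thesis using that by blast
qed

text \<open>
  With \<open>p = a * d\<close>, the off-diagonal corners \<open>p * c * (1 - p)\<close> and \<open>(1 - p) * c * p\<close>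
  contain a factor \<open>a\<^sup>k\<close>, which passes through \<open>c\<close> and annihilates \<open>1 - p\<close>.  So
  \<open>c\<close> commutes with \<open>p\<close>, and \<open>d\<close> inverts \<open>a\<close> on the range of \<open>p\<close>.
\<close>
lemma drazin_inverse_bicommutant:
  fixes a d c :: "'a::{ring, monoid_mult}"
  assumes d: "is_drazin_inverse a d" and c: "commuting c a"
  shows "commuting c d"
proof -
  note f = drazin_inverse_facts[OF d]
  obtain k where k: "a ^ k * (1 - a * d) = 0" "a * d = a ^ k * d ^ k" "a * d = d ^ k * a ^ k"
    by (rule drazin_idempotent_power[OF d])
  have ck: "c * a ^ k = a ^ k * c"
    using commuting_power[OF c] by (simp add: commuting_def)
  have k': "(1 - a * d) * a ^ k = 0"
    using k(1) commuting_power[OF commuting_sym[OF f(9)], of k] by (simp add: commuting_def)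
  have "a * d * c * (1 - a * d) = d ^ k * c * (a ^ k * (1 - a * d))"
    by (metis k(3) ck mult.assoc)
  then have 1: "a * d * c = a * d * c * (a * d)"
    using k(1) by (simp add: right_diff_distrib)
  have "(1 - a * d) * c * (a * d) = (1 - a * d) * a ^ k * c * d ^ k"
    by (metis k(2) ck mult.assoc)
  then have 2: "c * (a * d) = a * d * c * (a * d)"
    using k' by (simp add: left_diff_distrib)
  have pc: "a * d * c = c * (a * d)" using 1 2 by simp
  have "d * c = d * (a * d * c)" using f(3) by (metis mult.assoc)
  also have "\<dots> = d * (c * a) * d" using pc by (simp add: mult.assoc)
  also have "\<dots> = (a * d * c) * d" using c f(1) by (simp add: commuting_def mult.assoc)
  also have "\<dots> = c * d" using pc f(4) by (simp add: mult.assoc)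
  finally show ?thesis by (simp add: commuting_def)
qed

text \<open>
  The idempotents \<open>a * d\<close> and \<open>a * e\<close> absorb each other and commute by the previous
  lemma; hence they agree, and both \<open>d\<close> and \<open>e\<close> are the inverse of \<open>a\<close> in the same
  corner.
\<close>
lemma drazin_inverse_unique:
  fixes a d e :: "'a::{ring, monoid_mult}"
  assumes d: "is_drazin_inverse a d" and e: "is_drazin_inverse a e"
  shows "d = e"
proof -
  note fd = drazin_inverse_facts[OF d] and fe = drazin_inverse_facts[OF e]
  have absorb: "a * x = a * x * (a * y)"
    if x: "is_drazin_inverse a x" and y: "is_drazin_inverse a y" for x y
  proof -
    obtain k where k: "a ^ k * (1 - a * y) = 0"
      by (rule drazin_idempotent_power[OF y])
    have "a * x = (a * x) * (a * x) ^ k"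
      using idempotent_power[OF drazin_inverse_facts(5)[OF x]] by simp
    also have "(a * x) ^ k = x ^ k * a ^ k"
      using power_mult_commuting[of x a k] drazin_inverse_facts(1)[OF x]
      by (simp add: commuting_def)
    finally have "a * x * (1 - a * y) = a * x * x ^ k * (a ^ k * (1 - a * y))"
      by (metis mult.assoc)
    then show ?thesis using k by (simp add: right_diff_distrib)
  qed
  have "commuting e d"
    using drazin_inverse_bicommutant[OF d] fe(7) commuting_sym by blast
  then have "a * d * (a * e) = a * e * (a * d)"
    using fd(1) fe(1) by (metis commuting_def mult.assoc)
  then have p: "a * d = a * e"
    using absorb[OF d e] absorb[OF e d] by simp
  have "d = d * (a * e)" using p fd(3) by simp
  also have "\<dots> = a * e * e" using p fd(1) by (metis mult.assoc)
  finally show ?thesis using fe(4) by simp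
qed

lemma drazin_inverse_eqI:
  fixes a d :: "'a::{ring, monoid_mult}"
  assumes "is_drazin_inverse a d"
  shows "a\<^sup>D = d"
  unfolding drazin_inverse_def
  using assms drazin_inverse_unique by (intro the_equality) blast+

lemma is_drazin_inverse_drazin_inverse:
  fixes a :: "'a::{ring, monoid_mult}"
  assumes "drazin_invertible a"
  shows "is_drazin_inverse a (a\<^sup>D)"
  using assms drazin_inverse_eqI unfolding drazin_invertible_def by metis

lemma drazin_index_annihilates:
  fixes a :: "'a::{ring, monoid_mult}"
  assumes "drazin_invertible a"
  shows "(a * (1 - a * a\<^sup>D)) ^ drazin_index a = 0"
proof -
  have "\<exists>k. (a * (1 - a * a\<^sup>D)) ^ k = 0"
    using is_drazin_inverse_drazin_inverse[OF assms]
    unfolding is_drazin_inverse_def nilpotent_def by blast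
  then show ?thesis unfolding drazin_index_def by (rule LeastI_ex)
qed

lemma drazin_inverse_square:
  fixes a d :: "'a::{ring, monoid_mult}"
  assumes d: "is_drazin_inverse a d"
  shows "is_drazin_inverse (a * a) (d * d)" "(a * a) * (d * d) = a * d"
proof -
  note f = drazin_inverse_facts[OF d]
  show p: "(a * a) * (d * d) = a * d"
    using f(5) by (metis f(1) mult.assoc)
  have "(a * a) * (1 - a * d) = (a * (1 - a * d)) * a"
    using f(9) by (metis commuting_def mult.assoc)
  moreover have "nilpotent \<dots>"
    by (intro nilpotent_mult_commuting f(10)) (simp add: commuting_intros commuting_sym[OF f(9)])
  ultimately show "is_drazin_inverse (a * a) (d * d)"
    unfolding is_drazin_inverse_def p using f(1-5) p by (metis mult.assoc)
qed

text \<open>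
  An element that commutes only with the square of \<open>a\<close> still commutes with the
  idempotent of \<open>a\<close>, because \<open>a\<close> and its square have the same idempotent.
\<close>
lemma drazin_inverse_commuting_square:
  fixes a d c :: "'a::{ring, monoid_mult}"
  assumes d: "is_drazin_inverse a d" and c: "commuting c (a * a)"
  shows "commuting c (d * d)" "commuting c (a * d)"
proof -
  show "commuting c (d * d)"
    by (rule drazin_inverse_bicommutant[OF drazin_inverse_square(1)[OF d] c])
  with c show "commuting c (a * d)"
    using commuting_mult drazin_inverse_square(2)[OF d] by metis
qed

section \<open>Drazin inverses of corners, orthogonal sums and perturbations\<close>

lemma drazin_inverse_corner:
  fixes a d q :: "'a::{ring, monoid_mult}"
  assumes d: "is_drazin_inverse a d" and q: "q * q = q" "commuting q a"
  shows "is_drazin_inverse (a * q) (q * d)"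
proof -
  note f = drazin_inverse_facts[OF d]
  have qd: "q * d = d * q" and qa: "q * a = a * q"
    using drazin_inverse_bicommutant[OF d q(2)] q(2) by (simp_all add: commuting_def)
  have p: "(a * q) * (q * d) = (a * d) * q" "(q * d) * (a * q) = (a * d) * q"
    using q(1) qd qa f(1) by (metis mult.assoc)+
  have "(a * d) * q * (q * d) = q * d"
    using f(4) q(1) qd by (metis mult.assoc)
  moreover have "(a * q) * (1 - (a * d) * q) = (a * (1 - a * d)) * q"
    using q(1) qd qa by (simp add: right_diff_distrib left_diff_distrib) (metis mult.assoc)
  moreover have "nilpotent \<dots>"
  proof (rule nilpotent_mult_commuting)
    show "commuting (a * (1 - a * d)) q"
      using q(2) drazin_inverse_bicommutant[OF d q(2)]
      by (intro commuting_sym[of q]) (simp add: commuting_intros)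
  qed (fact f(10))
  ultimately show ?thesis
    unfolding is_drazin_inverse_def p by simp
qed

lemma drazin_inverse_orthogonal_add:
  fixes a b d e :: "'a::{ring, monoid_mult}"
  assumes d: "is_drazin_inverse a d" and e: "is_drazin_inverse b e"
    and ab: "a * b = 0" "b * a = 0"
  shows "is_drazin_inverse (a + b) (d + e)"
proof -
  note fd = drazin_inverse_facts[OF d] and fe = drazin_inverse_facts[OF e]
  have z: "a * e = 0" "e * a = 0" "b * d = 0" "d * b = 0" "d * e = 0" "e * d = 0"
    using ab fd(1-4) fe(1-4) by (metis mult.assoc mult_zero_left mult_zero_right)+
  have p: "(a + b) * (d + e) = a * d + b * e" "(d + e) * (a + b) = a * d + b * e"
    using z fd(1) fe(1) by (simp_all add: distrib_left distrib_right)
  have "(a * d + b * e) * (d + e) = d + e"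
    using z fd(4) fe(4) by (simp add: distrib_left distrib_right mult.assoc)
  moreover have "(a + b) * (1 - (a * d + b * e)) = a * (1 - a * d) + b * (1 - b * e)"
    using ab by (simp add: algebra_simps flip: mult.assoc)
  moreover have "nilpotent (a * (1 - a * d) + b * (1 - b * e))"
  proof (rule nilpotent_add_commuting)
    have "commuting a b" "commuting a e" "commuting d b" "commuting d e"
      using ab z by (simp_all add: commuting_def)
    then show "commuting (a * (1 - a * d)) (b * (1 - b * e))"
      by (simp add: commuting_intros)
  qed (fact fd(10) fe(10))+
  ultimately show ?thesis
    unfolding is_drazin_inverse_def p by simp
qed

text \<open>
  Since the idempotent \<open>r = b * d\<close> commutes with \<open>a\<close>, one has
  \<open>(a + b) * d = r * (1 + a * d)\<close> and \<open>d * (a + b) = (1 + d * a) * r\<close>.  Inverting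
  \<open>1 + a * d\<close> on the right and \<open>1 + d * a\<close> on the left shows that \<open>d * y\<close> inverts
  \<open>a + b\<close> up to \<open>r\<close> on both sides.
\<close>
lemma drazin_inverse_perturbation:
  fixes a b d y :: "'a::{ring, monoid_mult}"
  assumes d: "is_drazin_inverse b d" and r: "commuting a (b * d)"
    and y: "is_two_sided_inverse (a * d + 1) y"
    and nil: "nilpotent ((a + b) * (1 - b * d))"
  shows "is_drazin_inverse (a + b) (d * y)"
proof -
  note f = drazin_inverse_facts[OF d]
  have y1: "(a * d + 1) * y = 1" and y2: "y * (a * d + 1) = 1"
    using y by (simp_all add: is_two_sided_inverse_def)
  have ad: "a * d = (b * d) * (a * d)" and da: "d * a = d * a * (b * d)"
    using r f(3,4) by (metis commuting_def mult.assoc)+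
  have "(a + b) * d = (b * d) * (a * d + 1)"
    using ad by (simp add: distrib_left distrib_right)
  then have 1: "(a + b) * (d * y) = b * d"
    using y1 by (metis mult.assoc mult_1_right)
  \<comment> \<open>Jacobson's lemma: an inverse of \<open>1 + a * d\<close> yields one of \<open>1 + d * a\<close>.\<close>
  define z where "z = 1 - d * y * a"
  have z: "z * (d * a + 1) = 1"
  proof -
    have "z * (d * a + 1) = d * a + 1 - d * (y * (a * d + 1)) * a"
      unfolding z_def by (simp add: algebra_simps)
    then show ?thesis using y2 by simp
  qed
  have "z * d = z * (d * (a * d + 1)) * y"
    using y1 by (simp add: mult.assoc)
  also have "d * (a * d + 1) = (d * a + 1) * d"
    by (simp add: distrib_left distrib_right mult.assoc)
  also have "z * ((d * a + 1) * d) * y = d * y"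
    using z by (simp flip: mult.assoc)
  finally have zd: "z * d = d * y" .
  have "d * (a + b) = (d * a + 1) * (b * d)"
    using da f(1) by (simp add: distrib_left distrib_right)
  then have 2: "(d * y) * (a + b) = b * d"
    using z zd by (metis mult.assoc mult_1_left)
  have 3: "b * d * (d * y) = d * y"
    using f(4) by (simp flip: mult.assoc)
  show ?thesis
    unfolding is_drazin_inverse_def 1 2 using 3 nil by simp
qed

section \<open>Weakly commuting elements\<close>

lemma left_weakly_commutative_square:
  assumes "left_weakly_commutative a b"
  shows "commuting (a * a) b"
  using assms unfolding left_weakly_commutative_def commuting_def by (metis mult.assoc)

lemma right_weakly_commutative_iff_left:
  "right_weakly_commutative a b \<longleftrightarrow> left_weakly_commutative b a"
  unfolding right_weakly_commutative_def left_weakly_commutative_def by metis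

text \<open>
  Weak commutativity survives multiplication by elements that commute with the rest,
  with witness \<open>c * v\<close>.  Although \<open>u\<close> need not commute with \<open>c\<close>, it can be moved
  past \<open>c * a\<close>, which is \<open>a * b\<close>.
\<close>
lemma left_weakly_commutative_mult:
  assumes "left_weakly_commutative a b"
    and "commuting u a" "commuting u b" "commuting v a" "commuting u v"
  shows "left_weakly_commutative (a * u) (b * v)"
proof -
  from assms(1) obtain c where c: "a * b = c * a" "b * a = a * c"
    by (auto simp: left_weakly_commutative_def)
  have "a * u * (b * v) = c * v * (a * u)" "b * v * (a * u) = a * u * (c * v)"
    using assms(2-) c unfolding commuting_def by (metis mult.assoc)+
  then show ?thesis unfolding left_weakly_commutative_def by blast
qed

text \<open>
  Both \<open>b\<close> and the witness \<open>c\<close> can be moved to the right of a factor \<open>a\<close>, where they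
  turn into each other: \<open>b * a = a * c\<close> and \<open>c * a = a * b\<close>.  So all factors \<open>a\<close> in
  \<open>(a * b)\<^sup>n\<close> can be collected on the left.  The induction below exploits that the
  hypotheses are symmetric in \<open>x\<close> and \<open>c\<close>.
\<close>
lemma left_weakly_commutative_power:
  fixes a b :: "'a::monoid_mult"
  assumes "left_weakly_commutative a b"
  obtains y where "(a * b) ^ n = a ^ n * y"
proof -
  have shift: "\<exists>y. x * a ^ n = a ^ n * y" if "a * x = c * a" "x * a = a * c" for x c n
    using that
  proof (induction n arbitrary: x c)
    case (Suc n)
    from Suc.IH[of c x] Suc.prems obtain y where "c * a ^ n = a ^ n * y" by metis
    then have "x * a ^ Suc n = a ^ Suc n * y"
      using Suc.prems by simp (metis mult.assoc)
    then show ?case by blast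
  qed simp
  have "\<exists>y. (a * b) ^ n = a ^ n * y"
  proof (induction n)
    case (Suc n)
    then obtain y where y: "(a * b) ^ n = a ^ n * y" by blast
    from assms shift obtain z where "b * a ^ n = a ^ n * z"
      unfolding left_weakly_commutative_def by metis
    then have "(a * b) ^ Suc n = a ^ Suc n * (z * y)"
      using y by simp (metis mult.assoc)
    then show ?case by blast
  qed simp
  with that show thesis by blast
qed

text \<open>
  In \<open>(a + b)\<^sup>2 = (a\<^sup>2 + b\<^sup>2) + (a * b + b * a)\<close> all four summands are nilpotent
  and commute with each other: the squares commute with \<open>a\<close> and \<open>b\<close>, and
  \<open>a * b\<close> and \<open>b * a\<close> have product \<open>a\<^sup>2 * b\<^sup>2\<close> in either order.
\<close>
lemma nilpotent_add_weakly_commutative: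
  fixes a b :: "'a::{ring, monoid_mult}"
  assumes w: "weakly_commutative a b" and a: "nilpotent a" and b: "nilpotent b"
  shows "nilpotent (a + b)"
proof -
  have lw: "left_weakly_commutative a b" and rw: "left_weakly_commutative b a"
    using w by (simp_all add: weakly_commutative_def right_weakly_commutative_iff_left)
  have ca: "commuting (a * a) b" and cb: "commuting (b * b) a"
    using left_weakly_commutative_square lw rw by blast+
  have sq: "nilpotent (x * x)" if "nilpotent x" for x :: 'a
    using that by (rule nilpotent_mult_commuting) simp
  have "nilpotent (a * b)"
    using a left_weakly_commutative_power[OF lw] unfolding nilpotent_def
    by (metis mult_zero_left)
  moreover from this have "nilpotent (b * a)" by (rule nilpotent_swap)
  moreover have "commuting (a * b) (b * a)"
    using ca cb unfolding commuting_def by (metis mult.assoc)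
  ultimately have "nilpotent (a * b + b * a)" by (rule nilpotent_add_commuting)
  moreover have "nilpotent (a * a + b * b)"
    using ca by (intro nilpotent_add_commuting sq a b commuting_mult)
  moreover have "commuting (a * a + b * b) (a * b + b * a)"
  proof -
    have "commuting (a * a) a" "commuting (b * b) b" by (simp_all add: commuting_intros)
    with ca cb show ?thesis
      by (intro commuting_add_left commuting_add commuting_mult)
  qed
  ultimately have "nilpotent ((a * a + b * b) + (a * b + b * a))"
    using nilpotent_add_commuting by blast
  also have "(a * a + b * b) + (a * b + b * a) = (a + b) ^ 2"
    by (simp add: power2_eq_square algebra_simps)
  finally show ?thesis
    unfolding nilpotent_def by (metis power_mult)
qed

section \<open>The Drazin inverse of a sum\<close>

text \<open>
  The formula holds in every ring, for any Drazin inverses \<open>d\<close>, \<open>e\<close>, \<open>f\<close> and any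
  exponent \<open>k\<close> that annihilates the nilpotent part of \<open>a\<close>.
\<close>
theorem drazin_inverse_add_weakly_commutative:
  fixes a b d e f :: "'a::{ring, monoid_mult}"
  assumes d: "is_drazin_inverse a d" and e: "is_drazin_inverse b e"
    and w: "weakly_commutative a b"
    and f: "is_drazin_inverse (a ^ 2 * d * (1 + d * b)) f"
    and k: "(a * (1 - a * d)) ^ k = 0"
  shows "\<exists>y. is_two_sided_inverse (a * (1 - a * d) * e + 1) y
    \<and> is_drazin_inverse (a + b) (f + (1 - a * d) * e * y)
    \<and> (1 - a * d) * e * y = (1 - a * d) * e * (\<Sum>n<k. (- (a * b)) ^ n * e ^ (2 * n))"
proof -
  define p q where "p = a * d" and "q = 1 - p"
  note fd = drazin_inverse_facts[OF d, folded p_def, folded q_def]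
  note fe = drazin_inverse_facts[OF e]
  have lw: "left_weakly_commutative a b" and rw: "left_weakly_commutative b a"
    using w by (simp_all add: weakly_commutative_def right_weakly_commutative_iff_left)
  have "commuting b (a * a)" "commuting a (b * b)"
    using left_weakly_commutative_square lw rw commuting_sym by blast+
  then have pb: "commuting b p"
    and ra: "commuting a (b * e)" and sa: "commuting a (e * e)"
    using drazin_inverse_commuting_square d e unfolding p_def by blast+
  have qa: "commuting q a" and qb: "commuting q b"
    using commuting_sym[OF fd(9)] commuting_sym[OF pb] unfolding q_def
    by (simp_all add: commuting_diff_left)
  have qe: "commuting q e" by (rule drazin_inverse_bicommutant[OF e qb])
  have sb: "commuting b (e * e)"
    using fe(7) by (intro commuting_mult)
  have qs: "commuting q (e * e)" using qe by (intro commuting_mult)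

  have core: "a ^ 2 * d * (1 + d * b) = p * (a + b)"
  proof -
    have "a ^ 2 * d = a * p" "a ^ 2 * d * d = p"
      using drazin_inverse_square(2)[OF d] by (simp_all add: p_def power2_eq_square mult.assoc)
    then show ?thesis
      using fd(8) by (simp add: commuting_def distrib_left flip: mult.assoc)
  qed

  define x where "x = a * q * e"
  \<comment> \<open>Replacing \<open>e\<close> by \<open>b * (e * e)\<close> exchanges it, which need not commute with
    \<open>a\<close>, for the square \<open>e * e\<close>, which does.\<close>
  have x: "- x = (- (a * b)) * (q * (e * e))"
  proof -
    have "e = b * (e * e)" using fe(4) by (simp add: mult.assoc)
    then have "a * q * e = a * (q * b) * (e * e)" by (metis mult.assoc)
    also have "\<dots> = (a * b) * (q * (e * e))"
      using qb by (metis commuting_def mult.assoc)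
    finally show ?thesis by (simp add: x_def)
  qed
  have xk: "(- x) ^ k = 0"
  proof -
    have "left_weakly_commutative (a * q) (b * (- (e * e)))"
      by (intro left_weakly_commutative_mult lw qa qb commuting_minus[OF qs]
          commuting_sym[OF commuting_minus[OF sa]])
    then obtain z where "((a * q) * (b * (- (e * e)))) ^ k = (a * q) ^ k * z"
      by (rule left_weakly_commutative_power)
    moreover have "(a * q) * (b * (- (e * e))) = - x"
    proof -
      have "(a * q) * (b * (e * e)) = a * b * (q * (e * e))"
        using qb by (metis commuting_def mult.assoc)
      then show ?thesis using x by simp
    qed
    ultimately show ?thesis using k by (simp add: q_def p_def)
  qed
  define y where "y = (\<Sum>n<k. (- x) ^ n)"
  have y: "is_two_sided_inverse (x + 1) y"
    unfolding y_def by (rule neumann_series_nilpotent[OF xk])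

  have "q * e * (- x) ^ n = q * e * ((- (a * b)) ^ n * e ^ (2 * n))" for n
  proof -
    have ab: "commuting (q * (e * e)) (- (a * b))" and qab: "commuting q (- (a * b))"
      using qa qb commuting_sym[OF sa] commuting_sym[OF sb]
      by (simp_all only: commuting_minus commuting_mult commuting_mult_left)
    have "(- x) ^ n = (- (a * b)) ^ n * (q ^ n * (e * e) ^ n)"
      unfolding x power_mult_commuting[OF commuting_sym[OF ab]] power_mult_commuting[OF qs] ..
    moreover have "commuting q ((- (a * b)) ^ n)"
      by (rule commuting_power[OF qab])
    ultimately have "q * e * (- x) ^ n = e * (- (a * b)) ^ n * (q * q ^ n) * (e * e) ^ n"
      using qe by (metis commuting_def mult.assoc)
    also have "q * q ^ n = q"
      by (rule idempotent_power[OF fd(6)])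
    also have "e * (- (a * b)) ^ n * q * (e * e) ^ n = q * e * ((- (a * b)) ^ n * (e * e) ^ n)"
      using qe \<open>commuting q ((- (a * b)) ^ n)\<close> by (metis commuting_def mult.assoc)
    finally show ?thesis by (simp add: power_mult power2_eq_square)
  qed
  then have series: "q * e * y = q * e * (\<Sum>n<k. (- (a * b)) ^ n * e ^ (2 * n))"
    by (simp add: y_def sum_distrib_left)

  have corner: "is_drazin_inverse (a * q + b * q) (q * e * y)"
  proof (rule drazin_inverse_perturbation)
    show be: "is_drazin_inverse (b * q) (q * e)"
      by (rule drazin_inverse_corner[OF e fd(6) qb])
    \<comment> \<open>The idempotent of the part on which both \<open>a\<close> and \<open>b\<close> are nilpotent.\<close>
    define u where "u = q * (1 - b * q * (q * e))"
    have ua: "commuting u a" and ub: "commuting u b" and uq: "commuting u q"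
      and r: "b * q * (q * e) = q * (b * e)"
    proof -
      show r: "b * q * (q * e) = q * (b * e)"
        using fd(6) qb by (metis commuting_def mult.assoc)
      show "commuting u a" "commuting u b" "commuting u q"
        unfolding u_def r using qa qb qe commuting_sym[OF ra] commuting_sym[OF qb]
          commuting_sym[OF fe(7)] commuting_sym[OF qe]
        by (simp_all add: commuting_intros)
    qed
    show "commuting (a * q) (b * q * (q * e))"
      unfolding r
    proof (rule commuting_mult_left)
      show "commuting a (q * (b * e))"
        using commuting_sym[OF qa] ra by (rule commuting_mult)
      show "commuting q (q * (b * e))"
        using qb qe by (intro commuting_mult commuting_refl)
    qed
    show "is_two_sided_inverse (a * q * (q * e) + 1) y"
      using y fd(6) unfolding x_def by (metis mult.assoc)
    have "weakly_commutative (a * u) (b * u)"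
      using lw rw ua ub left_weakly_commutative_mult
      unfolding weakly_commutative_def right_weakly_commutative_iff_left
      by (metis commuting_refl)
    moreover have "nilpotent (a * u)"
    proof -
      have "nilpotent (a * q)"
        using k unfolding nilpotent_def q_def p_def by blast
      moreover have "commuting (a * q) u"
        using ua uq by (simp add: commuting_mult_left commuting_sym)
      ultimately have "nilpotent (a * q * u)" by (rule nilpotent_mult_commuting)
      moreover have "a * q * u = a * u"
        using fd(6) by (simp add: u_def mult.assoc) (metis mult.assoc)
      ultimately show ?thesis by simp
    qed
    moreover have "nilpotent (b * u)"
      using drazin_inverse_facts(10)[OF be] by (simp add: u_def mult.assoc)
    ultimately have "nilpotent (a * u + b * u)"
      by (rule nilpotent_add_weakly_commutative)
    then show "nilpotent ((a * q + b * q) * (1 - b * q * (q * e)))"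
      by (simp add: u_def distrib_right mult.assoc)
  qed
  have pq: "p * q = 0" "q * p = 0"
    using fd(5) by (simp_all add: q_def algebra_simps)
  have "is_drazin_inverse (p * (a + b) + (a * q + b * q)) (f + q * e * y)"
  proof (rule drazin_inverse_orthogonal_add)
    have "a * q + b * q = q * (a + b)"
      using qa qb by (simp add: commuting_def distrib_left)
    moreover have "commuting q (a + b)" "commuting p (a + b)"
      using qa qb commuting_sym[OF fd(8)] commuting_sym[OF pb] by (simp_all only: commuting_add)
    ultimately show "p * (a + b) * (a * q + b * q) = 0" "(a * q + b * q) * (p * (a + b)) = 0"
      using pq unfolding commuting_def by (metis mult.assoc mult_zero_left mult_zero_right)+
  qed (use f core corner in simp_all)
  moreover have "p * (a + b) + (a * q + b * q) = a + b"
    using fd(8) pb by (simp add: q_def commuting_def algebra_simps)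
  ultimately show ?thesis
    using y series by (auto simp: x_def q_def p_def)
qed

theorem theorem2p12:
  fixes A B :: "'a::complex_banach bounded_op"
  assumes "drazin_invertible A"
    and "drazin_invertible B"
    and "weakly_commutative A B"
    and "drazin_invertible (A ^ 2 * A\<^sup>D * (1 + A\<^sup>D * B))"
  shows "drazin_invertible (A + B)
    \<and> two_sided_invertible (A * (1 - A * A\<^sup>D) * B\<^sup>D + 1)
    \<and> (A + B)\<^sup>D = (A ^ 2 * A\<^sup>D * (1 + A\<^sup>D * B))\<^sup>D
        + (1 - A * A\<^sup>D) * B\<^sup>D * two_sided_inverse (A * (1 - A * A\<^sup>D) * B\<^sup>D + 1)
    \<and> (A + B)\<^sup>D = (A ^ 2 * A\<^sup>D * (1 + A\<^sup>D * B))\<^sup>D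
        + (1 - A * A\<^sup>D) * B\<^sup>D
            * (\<Sum>n<drazin_index A. (- (A * B)) ^ n * (B\<^sup>D) ^ (2 * n))"
proof -
  let ?S = "A ^ 2 * A\<^sup>D * (1 + A\<^sup>D * B)"
  obtain y where y: "is_two_sided_inverse (A * (1 - A * A\<^sup>D) * B\<^sup>D + 1) y"
    and D: "is_drazin_inverse (A + B) (?S\<^sup>D + (1 - A * A\<^sup>D) * B\<^sup>D * y)"
    and s: "(1 - A * A\<^sup>D) * B\<^sup>D * y = (1 - A * A\<^sup>D) * B\<^sup>D
            * (\<Sum>n<drazin_index A. (- (A * B)) ^ n * (B\<^sup>D) ^ (2 * n))"
    using drazin_inverse_add_weakly_commutative[OF
        is_drazin_inverse_drazin_inverse[OF assms(1)]
        is_drazin_inverse_drazin_inverse[OF assms(2)] assms(3)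
        is_drazin_inverse_drazin_inverse[OF assms(4)]
        drazin_index_annihilates[OF assms(1)]]
    by blast
  have "(A + B)\<^sup>D = ?S\<^sup>D + (1 - A * A\<^sup>D) * B\<^sup>D * y"
    by (rule drazin_inverse_eqI[OF D])
  then show ?thesis
    using D y s two_sided_inverse_eqI[OF y]
    unfolding drazin_invertible_def two_sided_invertible_def by auto
qed

end
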